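(* (In ZFC.) Let $\sigma\in\mathbb{Z}^{<\omega}$ be a reduced string and let $P(x_1,\dots,x_m)=\sum_{i=1}^m c_ix_i$ be a linear homogeneous polynomial with $c_1,\dots,c_m\in\mathbb{Z}\setminus\{0\}$. The following are equivalent: (1) for all (additively) idempotent ultrafilters $\mathcal{U}\in\beta\mathbb{Z}$, $\sigma\mathcal{U}\models P(x_1,\dots,x_m)=0$; (2) there exists a $(\sigma,P)$-ultrafilter $\mathcal{U}\in\beta\mathbb{Z}$ such that $\sigma\mathcal{U}\models P(x_1,\dots,x_m)=0$; (3) $P$ has a solution in $\mathfrak{G}(\sigma)$.
   Context: $\beta\mathbb{Z}$ is the set of all ultrafilters on $\mathbb{Z}$, with addition $A\in\mathcal{U}+\mathcal{V}\iff\{n\in\mathbb{Z}:\{k\in\mathbb{Z}:n+k\in A\}\in\mathcal{V}\}\in\mathcal{U}$; $\mathcal{U}$ is (additively) idempotent if $\mathcal{U}+\mathcal{U}=\mathcal{U}$. For $a\in\mathbb{Z}$, $a\,\mathcal{U}$ is the ultrafilter with $A\in a\,\mathcal{U}\iff\{n: an\in A\}\in\mathcal{U}$. For an ultrafilter $\mathcal{V}\in\beta\mathbb{Z}$, $\mathcal{V}\models P(x_1,\dots,x_m)=0$ means: for every $A\in\mathcal{V}$ there exist $b_1,\dots,b_m\in A$ with $P(b_1,\dots,b_m)=0$. $\mathbb{Z}^{<\omega}=\bigcup_{k\ge 0}\mathbb{Z}^k$ is the set of finite strings of integers (including the empty string). For $\sigma=(a_1,\dots,a_n)$, $\sigma\,\mathcal{U}=a_1\mathcal{U}+\dots+a_n\mathcal{U}$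 (the empty sum being the principal ultrafilter at $0$). A string $(a_1,\dots,a_n)$ is reduced if all $a_i\ne0$ and $a_i\ne a_{i+1}$ for $1\le i\le n-1$. For a sequence $(x_t)$ of integers, $\mathrm{FS}((x_t)_{t\ge k})=\{\sum_{t\in F}x_t: F\subseteq\{k,k+1,\dots\}\text{ finite non-empty}\}$. $(\sigma,P)$-ultrafilter: for $\sigma=(a_1,\dots,a_n)$ reduced and $P=\sum_{j=1}^m c_jx_j$ with all $c_j\in\mathbb{Z}\setminus\{0\}$, put $M=\sum_{i=1}^n\left(\sum_{j=1}^m|a_ic_j|\right)+1$. An idempotent ultrafilter $\mathcal{U}\in\beta\mathbb{Z}$ is a $(\sigma,P)$-ultrafilter if there is a sequence $(x_t)_{t\in\mathbb{N}}$ in $\mathbb{Z}$ such that for each $k\in\mathbb{N}$, $\mathrm{FS}((x_t)_{t\ge k})\in\mathcal{U}$ and $|x_{k+1}|>M\left|\sum_{i=1}^k x_i\right|$. $\approx$ is the smallest equivalence relation on $\mathbb{Z}^{<\omega}$ such that: the empty string is equivalent to $(0)$; $(a)\approx(a,a)$ for every $a\in\mathbb{Z}$; and $\sigma\approx\sigma'$, $\tau\approx\tau'$ imply $\sigma\tau\approx\sigma'\tau'$ (concatenation). $\mathfrak{G}(\sigma)$ is the $\approx$-equivalence class of $\sigma$. $P=\sum_{i=1}^m c_ix_i$ has a solution in $\mathfrak{G}(\sigma)$ if there are strings $\sigma_1,\dots,\sigma_m\in\mathfrak{G}(\sigma)$ all of the same length such that $\sum_{i=1}^m c_i\sigma_i=0$,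 where operations on strings are componentwise and $0$ is the all-zero string.
   Formalization: In (2), when M = 2 (that is, σ = (±1) and P = ±x₁), the ultrafilter U is also required not to be the principal ultrafilter at 0; without this, the principal ultrafilter at 0 satisfies (2) although (1) and (3) fail. *)

theory Defs
  imports Complex_Main
begin

text \<open>
  An ultrafilter on \<open>'a\<close> is a value of the library type \<open>'a filter\<close>; the set membership
  \<open>A \<in> U\<close> of the mathematical literature is \<open>eventually (\<lambda>n. n \<in> A) U\<close>.
\<close>

definition ultrafilter :: "'a filter \<Rightarrow> bool" where
  "ultrafilter U \<longleftrightarrow> U \<noteq> bot \<and> (\<forall>P. eventually P U \<or> eventually (\<lambda>x. \<not> P x) U)"

definition uf_add :: "int filter \<Rightarrow> int filter \<Rightarrow> int filter" where
  "uf_add U V = Abs_filter (\<lambda>P. eventually (\<lambda>n. eventually (\<lambda>k. P (n + k)) V) U)"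

lemma eventually_uf_add:
  "eventually P (uf_add U V) \<longleftrightarrow> eventually (\<lambda>n. eventually (\<lambda>k. P (n + k)) V) U"
  unfolding uf_add_def
proof (rule eventually_Abs_filter, rule is_filter.intro)
  show "eventually (\<lambda>n. eventually (\<lambda>k. True) V) U"
    by simp
next
  fix P Q :: "int \<Rightarrow> bool"
  assume "eventually (\<lambda>n. eventually (\<lambda>k. P (n + k)) V) U"
    and "eventually (\<lambda>n. eventually (\<lambda>k. Q (n + k)) V) U"
  then show "eventually (\<lambda>n. eventually (\<lambda>k. P (n + k) \<and> Q (n + k)) V) U"
    by eventually_elim (simp add: eventually_conj)
next
  fix P Q :: "int \<Rightarrow> bool"
  assume imp: "\<forall>x. P x \<longrightarrow> Q x"
    and "eventually (\<lambda>n. eventually (\<lambda>k. P (n + k)) V) U"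
  then show "eventually (\<lambda>n. eventually (\<lambda>k. Q (n + k)) V) U"
    by (elim eventually_mono) (use imp in auto)
qed

definition idempotent_ultrafilter :: "int filter \<Rightarrow> bool" where
  "idempotent_ultrafilter U \<longleftrightarrow> ultrafilter U \<and> uf_add U U = U"

text \<open>
  \<open>a U\<close> is \<open>filtermap ((*) a) U\<close>. The trailing summand \<open>principal {0}\<close> is neutral for
  \<open>uf_add\<close>.
\<close>

definition string_act :: "int list \<Rightarrow> int filter \<Rightarrow> int filter" where
  "string_act \<sigma> U = foldr (\<lambda>a V. uf_add (filtermap ((*) a) U) V) \<sigma> (principal {0})"

text \<open>An \<open>m\<close>-ary \<open>P\<close> is a function on lists, evaluated only at lists of length \<open>m\<close>.\<close>

definition models_zero :: "int filter \<Rightarrow> nat \<Rightarrow> (int list \<Rightarrow> int) \<Rightarrow> bool" where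
  "models_zero V m P \<longleftrightarrow>
    (\<forall>A. eventually (\<lambda>n. n \<in> A) V \<longrightarrow> (\<exists>b. length b = m \<and> set b \<subseteq> A \<and> P b = 0))"

definition lin_form :: "int list \<Rightarrow> int list \<Rightarrow> int" where
  "lin_form c x = (\<Sum>j<length c. c ! j * x ! j)"

definition reduced :: "int list \<Rightarrow> bool" where
  "reduced \<sigma> \<longleftrightarrow> (\<forall>i<length \<sigma>. \<sigma> ! i \<noteq> 0) \<and> (\<forall>i. Suc i < length \<sigma> \<longrightarrow> \<sigma> ! i \<noteq> \<sigma> ! Suc i)"

definition FS :: "(nat \<Rightarrow> int) \<Rightarrow> nat \<Rightarrow> int set" where
  "FS x k = {\<Sum>t\<in>F. x t | F. finite F \<and> F \<noteq> {} \<and> F \<subseteq> {k..}}"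

definition growth_const :: "int list \<Rightarrow> int list \<Rightarrow> int" where
  "growth_const \<sigma> c = (\<Sum>i<length \<sigma>. \<Sum>j<length c. \<bar>\<sigma> ! i * c ! j\<bar>) + 1"

text \<open>Sequences are indexed by the positive integers; \<open>x 0\<close> is never used.\<close>

definition sigma_P_ultrafilter :: "int list \<Rightarrow> int list \<Rightarrow> int filter \<Rightarrow> bool" where
  "sigma_P_ultrafilter \<sigma> c U \<longleftrightarrow> idempotent_ultrafilter U \<and>
    (\<exists>x :: nat \<Rightarrow> int. \<forall>k\<ge>1. eventually (\<lambda>n. n \<in> FS x k) U \<and>
       \<bar>x (k + 1)\<bar> > growth_const \<sigma> c * \<bar>\<Sum>i=1..k. x i\<bar>)"

inductive string_equiv :: "int list \<Rightarrow> int list \<Rightarrow> bool" (infix "\<approx>" 50) where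
  refl: "\<sigma> \<approx> \<sigma>"
| sym: "\<sigma> \<approx> \<tau> \<Longrightarrow> \<tau> \<approx> \<sigma>"
| trans: "\<sigma> \<approx> \<tau> \<Longrightarrow> \<tau> \<approx> \<rho> \<Longrightarrow> \<sigma> \<approx> \<rho>"
| zero: "[] \<approx> [0]"
| dup: "[a] \<approx> [a, a]"
| append: "\<sigma> \<approx> \<sigma>' \<Longrightarrow> \<tau> \<approx> \<tau>' \<Longrightarrow> \<sigma> @ \<tau> \<approx> \<sigma>' @ \<tau>'"

definition string_class :: "int list \<Rightarrow> int list set" where
  "string_class \<sigma> = {\<tau>. \<sigma> \<approx> \<tau>}"

text \<open>\<open>s ! j\<close> is the \<open>j\<close>-th string of the solution.\<close>

definition solvable_in_class :: "int list \<Rightarrow> int list \<Rightarrow> bool" where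
  "solvable_in_class c \<sigma> \<longleftrightarrow>
    (\<exists>s L. length s = length c \<and> set s \<subseteq> string_class \<sigma> \<and> (\<forall>\<tau>\<in>set s. length \<tau> = L) \<and>
       (\<forall>t<L. (\<Sum>j<length c. c ! j * (s ! j) ! t) = 0))"

text \<open>
  The growth condition bounds \<open>\<bar>\<Sum>x i\<bar>\<close>, not \<open>\<Sum>\<bar>x i\<bar>\<close>, so for growth constant 2 (that is,
  \<open>\<sigma> = (\<plusminus>1)\<close> and \<open>P = \<plusminus>x\<close>) cancellation allows 0 to lie in every \<open>FS x k\<close>. The
  principal ultrafilter at 0 is then a \<open>(\<sigma>,P)\<close>-ultrafilter, and it satisfies \<open>P = 0\<close>
  although \<open>P\<close> has no solution in the class of \<open>\<sigma>\<close>, as the following two lemmas show.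
  For \<open>\<sigma>\<close> reduced and all coefficients nonzero, the growth constant is 2 in no other case.
\<close>

lemma zero_is_sigma_P_ultrafilter:
  "sigma_P_ultrafilter [1] [1] (principal {0}) \<and>
   models_zero (string_act [1] (principal {0})) 1 (lin_form [1])"
proof
  define x :: "nat \<Rightarrow> int" where "x t = (-1) ^ t * (2 * int t - 1)" for t
  have "0 \<in> FS x k" for k
  proof -
    have "(\<Sum>t\<in>{k, k+1, k+3, k+4}. x t) = 0"
      by (simp add: x_def algebra_simps power_add)
    moreover have "finite {k, k+1, k+3, k+4}" "{k, k+1, k+3, k+4} \<noteq> {}"
      "{k, k+1, k+3, k+4} \<subseteq> {k..}"
      by auto
    ultimately show ?thesis
      unfolding FS_def by (smt (verit) mem_Collect_eq)
  qed
  moreover have S: "(\<Sum>i=1..k. x i) = (-1) ^ k * int k" for k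
    by (induction k) (auto simp: x_def algebra_simps)
  have "\<bar>x (k + 1)\<bar> > growth_const [1] [1] * \<bar>\<Sum>i=1..k. x i\<bar>" for k
    unfolding S by (simp add: x_def growth_const_def abs_mult)
  moreover have "uf_add (principal {0}) (principal {0}) = principal {0}"
    by (simp add: filter_eq_iff eventually_uf_add eventually_principal)
  ultimately show "sigma_P_ultrafilter [1] [1] (principal {0})"
    unfolding sigma_P_ultrafilter_def idempotent_ultrafilter_def ultrafilter_def
    by (auto simp: eventually_principal principal_eq_bot_iff)
  show "models_zero (string_act [1] (principal {0})) 1 (lin_form [1])"
    unfolding models_zero_def
  proof (intro allI impI)
    fix A assume "eventually (\<lambda>n. n \<in> A) (string_act [1] (principal {0::int}))"
    then have "0 \<in> A"
      by (simp add: string_act_def eventually_uf_add eventually_filtermap eventually_principal)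
    then show "\<exists>b. length b = 1 \<and> set b \<subseteq> A \<and> lin_form [1] b = 0"
      by (intro exI[of _ "[0]"]) (simp add: lin_form_def)
  qed
qed

lemma not_solvable_in_class_1: "\<not> solvable_in_class [1] [1]"
proof
  have inv: "\<sigma> \<approx> \<tau> \<Longrightarrow> set \<sigma> - {0} = set \<tau> - {0}" for \<sigma> \<tau>
    by (induction rule: string_equiv.induct) auto
  assume "solvable_in_class [1] [1]"
  then obtain s L where s: "length s = 1" "set s \<subseteq> string_class [1]"
      "\<forall>\<tau>\<in>set s. length \<tau> = L" "\<forall>t<L. (s ! 0) ! t = 0"
    unfolding solvable_in_class_def by auto
  then have "[1] \<approx> s ! 0" "length (s ! 0) = L"
    by (auto simp: string_class_def length_Suc_conv)
  moreover from this(1) have "1 \<in> set (s ! 0)"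
    using inv[of "[1]" "s ! 0"] by auto
  ultimately show False
    using s(4) by (force simp: in_set_conv_nth)
qed

end

theory Submission
  imports Defs
begin

text \<open>
  The conditions are proved equivalent in a cycle: from a solution in the class to all idempotents,
  from all idempotents to one \<open>(\<sigma>,P)\<close>-ultrafilter, and from there back to a solution.

  For an idempotent \<open>U\<close> the ultrafilter \<open>\<sigma> U\<close> depends only on the class of \<open>\<sigma>\<close>, because
  \<open>0 U\<close> is neutral and \<open>a U + a U = a (U + U) = a U\<close> (\<open>string_act_cong\<close>). So if \<open>s\<^sub>1, \<dots>, s\<^sub>m\<close> is a solution
  in the class, a set \<open>A\<close> of \<open>\<sigma> U\<close> belongs to every \<open>s\<^sub>j U\<close>. All \<open>s\<^sub>j\<close> have the same length, so integers
  \<open>y\<^sub>t\<close> can be chosen one after the other, each good for all \<open>j\<close> at once, such that every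
  \<open>b\<^sub>j = \<Sum>\<^sub>t s\<^sub>j(t) y\<^sub>t\<close> lies in \<open>A\<close> (\<open>string_act_common_point\<close>). Exchanging the order of summation gives
  \<open>\<Sum>\<^sub>j c\<^sub>j b\<^sub>j = 0\<close>.

  To pass from all idempotents to one, it suffices that some \<open>(\<sigma>,P)\<close>-ultrafilter other than
  the principal one at \<open>0\<close> exists. The powers of \<open>M + 1\<close>, with \<open>M\<close> the growth constant, grow fast enough, and the ultrafilters containing
  all sets \<open>FS x k\<close> form a closed subsemigroup, which contains an idempotent by the theorem of Ellis and
  Numakura (\<open>idempotent_ultrafilter_exists\<close>).

  Conversely, let \<open>x\<close> be the sequence of a \<open>(\<sigma>,P)\<close>-ultrafilter \<open>U\<close> with \<open>\<sigma> U \<Turnstile> P = 0\<close>. Almost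
  every element of \<open>\<sigma> U\<close> is a sum
  \<open>\<Sum>\<^sub>t d(t) x\<^sub>t\<close> whose coefficient string \<open>d\<close> is a block of \<open>a\<^sub>1\<close>s and zeros, then a block of \<open>a\<^sub>2\<close>s and
  zeros, and so on, hence a member of the class of \<open>\<sigma>\<close> (\<open>eventually_spells\<close>). A zero of \<open>P\<close> among such
  elements gives strings \<open>d\<^sub>1, \<dots>, d\<^sub>m\<close> in the class with \<open>\<Sum>\<^sub>t e(t) x\<^sub>t = 0\<close>, where \<open>e = \<Sum>\<^sub>j c\<^sub>j d\<^sub>j\<close>. These
  strings solve \<open>P\<close> as soon as \<open>e = 0\<close>, and this follows from the growth of \<open>x\<close> (\<open>expansion_unique\<close>).

  The last step needs care, because the growth condition bounds the partial sums \<open>S\<^sub>k\<close> of \<open>x\<close>, in which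
  terms may cancel, and not the sums of the \<open>\<bar>x\<^sub>t\<bar>\<close>. Summation by parts expresses \<open>\<Sum>\<^sub>t\<^sub>\<le>\<^sub>k e(t) x\<^sub>t\<close> by the
  \<open>S\<^sub>t\<close>, with coefficients \<open>e(k)\<close> at \<open>S\<^sub>k\<close> and \<open>e(t) - e(t+1)\<close> at the earlier ones. With \<open>E = M - 1\<close> the
  differences are at most \<open>E\<close>; if in addition \<open>\<bar>e(t)\<bar> \<le> E - 1\<close> and \<open>E \<ge> 2\<close>, the sum is at most
  \<open>(E + 1) \<bar>S\<^sub>k\<bar> < \<bar>x\<^sub>k\<^sub>+\<^sub>1\<bar>\<close>, which forces \<open>e(k+1) = 0\<close>. An empty \<open>\<sigma>\<close> is
  itself a solution; otherwise the two extra bounds hold except when \<open>\<sigma>\<close> has one entry and all \<open>c\<^sub>j\<close> have the same sign (\<open>abs_combination_le\<close>). That case contradicts \<open>\<sigma> U \<Turnstile> P = 0\<close>: \<open>U\<close> is not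
  principal at \<open>0\<close>, so it contains the positive or the negative integers, and a combination of integers
  of one sign with coefficients of one sign does not vanish (\<open>not_models_zero_same_sign\<close>).
\<close>

section \<open>Ultrafilters and their sums\<close>

lemma ultrafilter_not_eventually:
  assumes "ultrafilter U"
  shows "\<not> eventually P U \<longleftrightarrow> eventually (\<lambda>x. \<not> P x) U"
proof
  assume "eventually (\<lambda>x. \<not> P x) U"
  show "\<not> eventually P U"
  proof
    assume "eventually P U"
    with \<open>eventually (\<lambda>x. \<not> P x) U\<close> have "eventually (\<lambda>_. False) U"
      by eventually_elim simp
    then show False
      using assms by (simp add: ultrafilter_def)
  qed
qed (use assms in \<open>auto simp: ultrafilter_def\<close>)

lemma ultrafilter_eqI:
  assumes "F \<le> U" "F \<noteq> bot" "ultrafilter U"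
  shows "F = U"
proof (rule antisym[OF assms(1)], rule filter_leI)
  fix P assume P: "eventually P F"
  show "eventually P U"
  proof (rule ccontr)
    assume "\<not> eventually P U"
    then have "eventually (\<lambda>x. \<not> P x) F"
      using assms ultrafilter_not_eventually filter_leD by blast
    with P have "eventually (\<lambda>_. False) F"
      by eventually_elim simp
    with assms(2) show False by simp
  qed
qed

lemma ultrafilter_uf_add:
  assumes U: "ultrafilter U" and V: "ultrafilter V"
  shows "ultrafilter (uf_add U V)"
proof -
  have "uf_add U V \<noteq> bot"
    using U V by (simp add: trivial_limit_def eventually_uf_add ultrafilter_def)
  moreover have "eventually P (uf_add U V) \<or> eventually (\<lambda>x. \<not> P x) (uf_add U V)" for P
    unfolding eventually_uf_add ultrafilter_not_eventually[OF V, symmetric]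
    using U by (simp add: ultrafilter_def)
  ultimately show ?thesis
    by (simp add: ultrafilter_def)
qed

lemma uf_add_eqI:
  assumes "ultrafilter U" "ultrafilter V" "ultrafilter W" "uf_add U V \<le> W"
  shows "uf_add U V = W"
  using assms(4)
proof (rule ultrafilter_eqI)
  show "uf_add U V \<noteq> bot"
    using ultrafilter_uf_add[OF assms(1,2)] by (simp add: ultrafilter_def)
qed (rule assms(3))

lemma uf_add_assoc: "uf_add (uf_add U V) W = uf_add U (uf_add V W)"
  by (simp add: filter_eq_iff eventually_uf_add add.assoc)

lemma uf_add_zero_left: "uf_add (principal {0}) V = V"
  by (simp add: filter_eq_iff eventually_uf_add eventually_principal)

lemma uf_add_mono_left: "U \<le> U' \<Longrightarrow> uf_add U V \<le> uf_add U' V"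
  by (simp add: le_filter_def eventually_uf_add)

section \<open>Minimal filters and idempotents\<close>

text \<open>
  Zorn's lemma for filters. A filter stands for the closed set of ultrafilters below it, and the infimum
  of a chain for the intersection, so a minimal filter plays the role of a minimal compact set.
\<close>

lemma minimal_filter_exists:
  fixes F0 :: "'a filter"
  assumes F0: "Q F0"
    and chain: "\<And>C. C \<noteq> {} \<Longrightarrow> (\<And>F. F \<in> C \<Longrightarrow> Q F) \<Longrightarrow>
                  (\<And>F G. F \<in> C \<Longrightarrow> G \<in> C \<Longrightarrow> F \<le> G \<or> G \<le> F) \<Longrightarrow> Q (Inf C)"
  obtains F where "F \<le> F0" "Q F" "\<And>G. Q G \<Longrightarrow> G \<le> F \<Longrightarrow> G = F"
proof -
  let ?A = "{F. Q F \<and> F \<le> F0}"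
  have "\<exists>m\<in>?A. \<forall>a\<in>?A. a \<le> m \<longrightarrow> a = m"
  proof (rule predicate_Zorn)
    show "partial_order_on ?A (relation_of (\<lambda>F G. G \<le> F) ?A)"
      by (rule partial_order_on_relation_ofI) auto
    fix C assume "C \<in> Chains (relation_of (\<lambda>F G. G \<le> F) ?A)"
    then have C: "F \<in> C \<Longrightarrow> G \<in> C \<Longrightarrow> Q F \<and> F \<le> F0 \<and> (F \<le> G \<or> G \<le> F)" for F G
      unfolding Chains_def relation_of_def by blast
    show "\<exists>u\<in>?A. \<forall>a\<in>C. u \<le> a"
    proof (cases "C = {}")
      case True
      then show ?thesis using F0 by auto
    next
      case False
      then have "Q (Inf C)"
        by (rule chain) (use C in blast)+
      moreover have "Inf C \<le> F0"
        using False C by (metis Inf_lower2 ex_in_conv)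
      ultimately show ?thesis
        by (auto intro!: bexI[of _ "Inf C"] Inf_lower)
    qed
  qed
  then show ?thesis
    using that by (smt (verit) mem_Collect_eq order_trans)
qed

lemma Inf_chain_filter_neq_bot:
  assumes "C \<noteq> {}" "\<And>F. F \<in> C \<Longrightarrow> F \<noteq> bot"
    and "\<And>F G. F \<in> C \<Longrightarrow> G \<in> C \<Longrightarrow> F \<le> G \<or> G \<le> F"
  shows "Inf C \<noteq> (bot :: 'a filter)"
proof -
  have "eventually (\<lambda>_. False) (Inf C) \<longleftrightarrow> (\<exists>F\<in>C. eventually (\<lambda>_. False) F)"
    using assms(1)
  proof (rule eventually_Inf_base)
    fix F G assume "F \<in> C" "G \<in> C"
    then show "\<exists>x\<in>C. x \<le> inf F G"
      using assms(3)[of F G] by (metis inf.orderE inf.commute order_refl)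
  qed
  then show ?thesis
    using assms(2) by (auto simp: trivial_limit_def)
qed

text \<open>
  A minimal proper filter decides every predicate: restricting it to \<open>P\<close> either gives the improper
  filter or changes nothing.
\<close>

lemma ultrafilter_le_exists:
  assumes "F \<noteq> bot"
  obtains U where "ultrafilter U" "U \<le> F"
proof -
  obtain U where U: "U \<le> F" "U \<noteq> bot" and
      min: "\<And>G. G \<noteq> bot \<Longrightarrow> G \<le> U \<Longrightarrow> G = U"
  proof (rule minimal_filter_exists[of "\<lambda>F. F \<noteq> bot" F])
    fix C :: "'a filter set"
    assume "C \<noteq> {}" "\<And>F. F \<in> C \<Longrightarrow> F \<noteq> bot" "\<And>F G. F \<in> C \<Longrightarrow> G \<in> C \<Longrightarrow> F \<le> G \<or> G \<le> F"
    then show "Inf C \<noteq> bot" by (rule Inf_chain_filter_neq_bot)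
  qed (use assms in auto)
  have "eventually P U \<or> eventually (\<lambda>x. \<not> P x) U" for P
  proof (cases "inf U (principal {x. P x}) = bot")
    case True
    then have "eventually (\<lambda>_. False) (inf U (principal {x. P x}))"
      by simp
    then show ?thesis
      by (simp add: eventually_inf_principal)
  next
    case False
    then have "inf U (principal {x. P x}) = U"
      by (rule min) simp
    then have "U \<le> principal {x. P x}"
      by (metis inf.orderI)
    then show ?thesis
      by (simp add: le_principal)
  qed
  then show ?thesis
    using U that by (auto simp: ultrafilter_def)
qed

text \<open>
  A filter is the intersection of the ultrafilters finer than it.
\<close>

lemma filter_leI_ultrafilter:
  assumes "\<And>V. ultrafilter V \<Longrightarrow> V \<le> F \<Longrightarrow> eventually P V"
  shows "eventually P F"
proof (rule ccontr)
  assume "\<not> eventually P F"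
  then have "inf F (principal {x. \<not> P x}) \<noteq> bot"
    by (auto simp: trivial_limit_def eventually_inf_principal)
  then obtain V where V: "ultrafilter V" "V \<le> inf F (principal {x. \<not> P x})"
    by (rule ultrafilter_le_exists)
  then have "eventually P V" "eventually (\<lambda>x. \<not> P x) V"
    using assms by (auto simp: le_principal)
  then show False
    using V(1) ultrafilter_not_eventually by blast
qed

text \<open>
  The closed set of ultrafilters represented by \<open>F\<close> is a subsemigroup. Only ultrafilters are quantified
  over: the condition \<open>uf_add F F \<le> F\<close> on the filter itself would be stronger.
\<close>

definition add_closed :: "int filter \<Rightarrow> bool" where
  "add_closed F \<longleftrightarrow> (\<forall>U V. ultrafilter U \<longrightarrow> ultrafilter V \<longrightarrow> U \<le> F \<longrightarrow> V \<le> F \<longrightarrow> uf_add U V \<le> F)"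

text \<open>
  This is the closed set of all \<open>W\<close> below \<open>F\<close> with \<open>W + U\<close> below \<open>V\<close>, as \<open>le_translators_iff\<close>
  confirms. It is closed because \<open>W \<mapsto> W + U\<close> is continuous: the sets \<open>{n. A - n \<in> U}\<close>, for \<open>A\<close> in
  \<open>V\<close>, generate it together with \<open>F\<close>.
\<close>

definition translators :: "int filter \<Rightarrow> int filter \<Rightarrow> int filter \<Rightarrow> int filter" where
  "translators F U V = Abs_filter (\<lambda>P. \<exists>A. eventually A V \<and>
     eventually (\<lambda>n. eventually (\<lambda>k. A (n + k)) U \<longrightarrow> P n) F)"

lemma eventually_translators:
  "eventually P (translators F U V) \<longleftrightarrow> (\<exists>A. eventually A V \<and>
     eventually (\<lambda>n. eventually (\<lambda>k. A (n + k)) U \<longrightarrow> P n) F)"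
  unfolding translators_def
proof (rule eventually_Abs_filter, rule is_filter.intro)
  show "\<exists>A. eventually A V \<and> eventually (\<lambda>n. eventually (\<lambda>k. A (n + k)) U \<longrightarrow> True) F"
    by (auto intro: exI[of _ "\<lambda>_. True"])
next
  fix P Q :: "int \<Rightarrow> bool"
  assume "\<exists>A. eventually A V \<and> eventually (\<lambda>n. eventually (\<lambda>k. A (n + k)) U \<longrightarrow> P n) F"
    and "\<exists>A. eventually A V \<and> eventually (\<lambda>n. eventually (\<lambda>k. A (n + k)) U \<longrightarrow> Q n) F"
  then obtain A B where A: "eventually A V" "eventually (\<lambda>n. eventually (\<lambda>k. A (n + k)) U \<longrightarrow> P n) F"
    and B: "eventually B V" "eventually (\<lambda>n. eventually (\<lambda>k. B (n + k)) U \<longrightarrow> Q n) F"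
    by blast
  have "eventually (\<lambda>n. eventually (\<lambda>k. A (n + k) \<and> B (n + k)) U \<longrightarrow> P n \<and> Q n) F"
    using A(2) B(2) by eventually_elim (auto simp: eventually_conj_iff)
  then show "\<exists>A. eventually A V \<and> eventually (\<lambda>n. eventually (\<lambda>k. A (n + k)) U \<longrightarrow> P n \<and> Q n) F"
    using A(1) B(1) by (intro exI[of _ "\<lambda>x. A x \<and> B x"]) (simp add: eventually_conj)
next
  fix P Q :: "int \<Rightarrow> bool"
  assume imp: "\<forall>x. P x \<longrightarrow> Q x"
    and "\<exists>A. eventually A V \<and> eventually (\<lambda>n. eventually (\<lambda>k. A (n + k)) U \<longrightarrow> P n) F"
  then show "\<exists>A. eventually A V \<and> eventually (\<lambda>n. eventually (\<lambda>k. A (n + k)) U \<longrightarrow> Q n) F"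
    by (elim exE conjE) (rule exI, erule conjI, erule eventually_mono, simp)
qed

lemma le_translators_iff:
  "W \<le> translators F U V \<longleftrightarrow> W \<le> F \<and> uf_add W U \<le> V"
proof
  assume W: "W \<le> translators F U V"
  have "eventually P W" if "eventually P F" for P
    using that by (intro filter_leD[OF W])
      (auto simp: eventually_translators intro!: exI[of _ "\<lambda>_. True"] elim: eventually_mono)
  moreover have "eventually (\<lambda>n. eventually (\<lambda>k. A (n + k)) U) W" if "eventually A V" for A
    using that by (intro filter_leD[OF W]) (auto simp: eventually_translators)
  ultimately show "W \<le> F \<and> uf_add W U \<le> V"
    by (simp add: le_filter_def eventually_uf_add)
next
  assume W: "W \<le> F \<and> uf_add W U \<le> V"
  show "W \<le> translators F U V"
  proof (rule filter_leI)
    fix P assume "eventually P (translators F U V)"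
    then obtain A where A: "eventually A V"
        "eventually (\<lambda>n. eventually (\<lambda>k. A (n + k)) U \<longrightarrow> P n) F"
      unfolding eventually_translators by blast
    then have "eventually (\<lambda>n. eventually (\<lambda>k. A (n + k)) U) W"
        "eventually (\<lambda>n. eventually (\<lambda>k. A (n + k)) U \<longrightarrow> P n) W"
      using W by (auto simp: le_filter_def eventually_uf_add)
    then show "eventually P W"
      by eventually_elim simp
  qed
qed

text \<open>
  If \<open>F\<close> excluded some set \<open>{n. A - n \<in> U}\<close> with \<open>A\<close> in \<open>V\<close>, the complement of \<open>A\<close> would belong
  to \<open>F + U\<close> and hence to \<open>V\<close>.
\<close>

lemma translators_neq_bot:
  assumes U: "ultrafilter U" and V: "ultrafilter V" "V \<le> uf_add F U"
  shows "translators F U V \<noteq> bot"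
proof
  assume "translators F U V = bot"
  then have "eventually (\<lambda>_. False) (translators F U V)"
    by simp
  then obtain A where A: "eventually A V"
      "eventually (\<lambda>n. \<not> eventually (\<lambda>k. A (n + k)) U) F"
    unfolding eventually_translators by auto
  then have "eventually (\<lambda>x. \<not> A x) (uf_add F U)"
    by (simp add: eventually_uf_add ultrafilter_not_eventually[OF U])
  then have "eventually (\<lambda>x. \<not> A x) V"
    using V(2) filter_leD by blast
  then show False
    using A(1) ultrafilter_not_eventually[OF V(1)] by blast
qed

text \<open>
  The set of ultrafilters below \<open>uf_add F U\<close> is exactly \<open>{W + U. W \<le> F}\<close>, the continuous image of a
  compact set.
\<close>

lemma obtain_left_summand:
  assumes "ultrafilter U" "ultrafilter V" "V \<le> uf_add F U"
  obtains W where "ultrafilter W" "W \<le> F" "uf_add W U = V"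
proof -
  obtain W where W: "ultrafilter W" "W \<le> translators F U V"
    using translators_neq_bot[OF assms] by (rule ultrafilter_le_exists)
  moreover have "uf_add W U = V"
    using W assms by (intro uf_add_eqI) (simp_all add: le_translators_iff)
  ultimately show ?thesis
    using that le_translators_iff[of W F U V] by blast
qed

text \<open>
  The theorem of Ellis and Numakura. Let \<open>F\<close> be a minimal closed subsemigroup and \<open>U\<close> an element. Then
  \<open>F + U\<close> is a closed subsemigroup of \<open>F\<close>, hence all of \<open>F\<close>, so that \<open>U = W + U\<close> for some \<open>W\<close>
  in \<open>F\<close>. The set of all such \<open>W\<close> is therefore nonempty; as it is again a closed subsemigroup, it is all
  of \<open>F\<close> and contains \<open>U\<close>.
\<close>

theorem idempotent_ultrafilter_exists:
  assumes "F0 \<noteq> bot" "add_closed F0"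
  obtains U where "idempotent_ultrafilter U" "U \<le> F0"
proof -
  obtain F where F: "F \<le> F0" "F \<noteq> bot" "add_closed F"
    and min: "\<And>G. G \<noteq> bot \<Longrightarrow> add_closed G \<Longrightarrow> G \<le> F \<Longrightarrow> G = F"
  proof (rule minimal_filter_exists[of "\<lambda>F. F \<noteq> bot \<and> add_closed F" F0])
    fix C :: "int filter set"
    assume C: "C \<noteq> {}" "\<And>F. F \<in> C \<Longrightarrow> F \<noteq> bot \<and> add_closed F"
      "\<And>F G. F \<in> C \<Longrightarrow> G \<in> C \<Longrightarrow> F \<le> G \<or> G \<le> F"
    then have "Inf C \<noteq> bot"
      by (intro Inf_chain_filter_neq_bot) auto
    moreover have "add_closed (Inf C)"
      using C(2) unfolding add_closed_def le_Inf_iff by blast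
    ultimately show "Inf C \<noteq> bot \<and> add_closed (Inf C)" ..
  qed (use assms in auto)
  obtain U where U: "ultrafilter U" "U \<le> F"
    using F(2) by (rule ultrafilter_le_exists)
  let ?G = "uf_add F U"
  have GF: "?G \<le> F"
  proof (rule filter_leI)
    fix P assume P: "eventually P F"
    show "eventually P ?G"
      unfolding eventually_uf_add
    proof (rule filter_leI_ultrafilter)
      fix V assume "ultrafilter V" "V \<le> F"
      then have "uf_add V U \<le> F"
        using F(3) U unfolding add_closed_def by blast
      then show "eventually (\<lambda>n. eventually (\<lambda>k. P (n + k)) U) V"
        using P by (simp add: le_filter_def eventually_uf_add)
    qed
  qed
  have "?G = F"
  proof (rule min[OF _ _ GF])
    show "?G \<noteq> bot"
      using F(2) U(1) by (simp add: trivial_limit_def eventually_uf_add ultrafilter_def)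
    show "add_closed ?G"
      unfolding add_closed_def
    proof (intro allI impI)
      fix V1 V2 assume V: "ultrafilter V1" "ultrafilter V2" "V1 \<le> ?G" "V2 \<le> ?G"
      obtain W where W: "ultrafilter W" "W \<le> F" "uf_add W U = V2"
        using U(1) V(2,4) by (rule obtain_left_summand)
      have "uf_add V1 W \<le> F"
        using V(1,3) W(1,2) GF F(3) order_trans[of V1 ?G F] unfolding add_closed_def by blast
      then have "uf_add (uf_add V1 W) U \<le> ?G"
        by (rule uf_add_mono_left)
      then show "uf_add V1 V2 \<le> ?G"
        by (simp add: uf_add_assoc W(3))
    qed
  qed
  let ?H = "translators F U U"
  have "?H = F"
  proof (rule min)
    show "?H \<noteq> bot"
      using U \<open>?G = F\<close> by (intro translators_neq_bot) auto
    show "?H \<le> F"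
      using le_translators_iff[of ?H F U U] by simp
    show "add_closed ?H"
      unfolding add_closed_def le_translators_iff
    proof (intro allI impI conjI; elim conjE)
      fix V W assume VW: "ultrafilter V" "ultrafilter W" "V \<le> F" "W \<le> F"
        "uf_add V U \<le> U" "uf_add W U \<le> U"
      show "uf_add V W \<le> F"
        using VW F(3) unfolding add_closed_def by blast
      have "uf_add W U = U"
        using VW U by (intro uf_add_eqI)
      then show "uf_add (uf_add V W) U \<le> U"
        using VW by (simp add: uf_add_assoc)
    qed
  qed
  then have "uf_add U U \<le> U"
    using U(2) le_translators_iff[of U F U U] by simp
  then have "uf_add U U = U"
    using U(1) by (intro uf_add_eqI)
  then show ?thesis
    using that U F(1) by (auto simp: idempotent_ultrafilter_def)
qed

section \<open>Ultrafilters on finite sums\<close>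

lemma sum_in_FS: "finite F \<Longrightarrow> F \<noteq> {} \<Longrightarrow> F \<subseteq> {k..} \<Longrightarrow> (\<Sum>t\<in>F. x t) \<in> FS x k"
  unfolding FS_def by blast

lemma FS_antimono:
  assumes "k \<le> l"
  shows "FS x l \<subseteq> FS x k"
proof
  fix n assume "n \<in> FS x l"
  then obtain F where F: "finite F" "F \<noteq> {}" "F \<subseteq> {l..}" "n = (\<Sum>t\<in>F. x t)"
    unfolding FS_def by blast
  have "{l..} \<subseteq> {k..}"
    using assms by simp
  with F(3) have "F \<subseteq> {k..}"
    by (rule subset_trans)
  then show "n \<in> FS x k"
    using F(1,2,4) sum_in_FS by simp
qed

text \<open>
  Summands with indices beyond those used in \<open>n\<close> can be added without repeating an index. This is what
  makes the ultrafilters containing all \<open>FS x k\<close> a semigroup.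
\<close>

lemma FS_add:
  assumes "n \<in> FS x k"
  shows "\<exists>l. \<forall>m\<in>FS x l. n + m \<in> FS x k"
proof -
  obtain F where F: "finite F" "F \<noteq> {}" "F \<subseteq> {k..}" "n = (\<Sum>t\<in>F. x t)"
    using assms unfolding FS_def by blast
  define l where "l = Suc (Max F)"
  have l: "t < l" if "t \<in> F" for t
    unfolding l_def by (rule le_imp_less_Suc[OF Max_ge[OF F(1) that]])
  have "Max F \<in> {k..}"
    using F(3) Max_in[OF F(1,2)] by (rule subsetD)
  then have kl: "k \<le> l"
    by (simp add: l_def)
  have "n + m \<in> FS x k" if "m \<in> FS x l" for m
  proof -
    obtain G where G: "finite G" "G \<noteq> {}" "G \<subseteq> {l..}" "m = (\<Sum>t\<in>G. x t)"
      using \<open>m \<in> FS x l\<close> unfolding FS_def by blast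
    have "F \<inter> G = {}"
    proof (rule equals0I, elim IntE)
      fix t assume "t \<in> F" "t \<in> G"
      then show False
        using l[of t] subsetD[OF G(3), of t] by simp
    qed
    then have "n + m = (\<Sum>t\<in>F \<union> G. x t)"
      by (simp add: F(4) G(4) sum.union_disjoint[OF F(1) G(1)])
    moreover have "{l..} \<subseteq> {k..}"
      using kl by simp
    with G(3) have "G \<subseteq> {k..}"
      by (rule subset_trans)
    with F(3) have "F \<union> G \<subseteq> {k..}"
      by (rule Un_least)
    moreover have "finite (F \<union> G)" "F \<union> G \<noteq> {}"
      using F(1,2) G(1) by simp_all
    ultimately show ?thesis
      using sum_in_FS[of "F \<union> G" k x] by simp
  qed
  then show ?thesis
    by (intro exI[of _ l] ballI)
qed

lemma idempotent_ultrafilter_FS_exists: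
  obtains U where "idempotent_ultrafilter U" "\<And>k. eventually (\<lambda>n. n \<in> FS x k) U"
proof -
  let ?F = "INF k. principal (FS x k)"
  have le: "W \<le> ?F \<longleftrightarrow> (\<forall>k. eventually (\<lambda>n. n \<in> FS x k) W)" for W
    by (simp add: le_INF_iff le_principal)
  have "x k \<in> FS x k" for k
    using sum_in_FS[of "{k}" k x] by simp
  then have "?F \<noteq> bot"
  proof (subst INF_filter_bot_base)
    show "\<exists>k\<in>UNIV. principal (FS x k) \<le> inf (principal (FS x i)) (principal (FS x j))" for i j
      by (intro bexI[of _ "max i j"]) (auto intro: FS_antimono[THEN subsetD, rotated])
  qed (auto simp: principal_eq_bot_iff)
  moreover have "add_closed ?F"
    unfolding add_closed_def le
  proof (intro allI impI)
    fix U V k assume U: "\<forall>k. eventually (\<lambda>n. n \<in> FS x k) U"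
      and V: "\<forall>k. eventually (\<lambda>n. n \<in> FS x k) V"
    have "eventually (\<lambda>m. n + m \<in> FS x k) V" if n: "n \<in> FS x k" for n
    proof -
      obtain l where "\<forall>m\<in>FS x l. n + m \<in> FS x k"
        using FS_add[OF n] ..
      then show ?thesis
        by (intro eventually_mono[OF V[rule_format, of l]]) (rule bspec)
    qed
    then show "eventually (\<lambda>n. n \<in> FS x k) (uf_add U V)"
      unfolding eventually_uf_add by (rule eventually_mono[OF U[rule_format, of k]])
  qed
  ultimately obtain U where "idempotent_ultrafilter U" "U \<le> ?F"
    by (rule idempotent_ultrafilter_exists)
  then show ?thesis
    using that le by blast
qed

lemma sum_list_abs_nonneg: "(\<Sum>b\<leftarrow>c. \<bar>b :: int\<bar>) \<ge> 0"
  by (rule sum_list_nonneg) auto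

lemma growth_const_eq:
  "growth_const \<sigma> c = (\<Sum>a\<leftarrow>\<sigma>. \<bar>a\<bar>) * (\<Sum>b\<leftarrow>c. \<bar>b\<bar>) + 1"
  unfolding growth_const_def
  by (simp add: sum_list_sum_nth abs_mult sum_product atLeast0LessThan)

text \<open>
  Powers of \<open>M + 1\<close> satisfy the growth condition, by the geometric sum formula, and they are positive, so
  that \<open>0\<close> is not a finite sum.
\<close>

lemma sigma_P_ultrafilter_exists:
  obtains U where "sigma_P_ultrafilter \<sigma> c U" "U \<noteq> principal {0}"
proof -
  define M where "M = growth_const \<sigma> c"
  have M: "M \<ge> 1"
    unfolding M_def growth_const_eq by (simp add: sum_list_abs_nonneg)
  define x :: "nat \<Rightarrow> int" where "x t = (M + 1) ^ t" for t
  obtain U where U: "idempotent_ultrafilter U" "\<And>k. eventually (\<lambda>n. n \<in> FS x k) U"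
    using idempotent_ultrafilter_FS_exists[of x] by blast
  have S: "M * (\<Sum>i=1..k. x i) = (M + 1) ^ (k + 1) - (M + 1)" for k
    by (induction k) (auto simp: x_def algebra_simps)
  have "(\<Sum>i=1..k. x i) \<ge> 0" for k
    using M by (auto simp: x_def intro!: sum_nonneg)
  then have "\<bar>x (k + 1)\<bar> > M * \<bar>\<Sum>i=1..k. x i\<bar>" for k
    using S[of k] M by (simp add: x_def)
  then have "sigma_P_ultrafilter \<sigma> c U"
    unfolding sigma_P_ultrafilter_def using U M_def by blast
  moreover have "0 \<notin> FS x 1"
  proof -
    have "(\<Sum>t\<in>F. x t) > 0" if "finite F" "F \<noteq> {}" for F
      using that M by (intro sum_pos) (auto simp: x_def)
    then show ?thesis
      unfolding FS_def by force
  qed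
  then have "U \<noteq> principal {0}"
    using U(2)[of 1] by (auto simp: eventually_principal)
  ultimately show ?thesis
    using that by blast
qed

section \<open>Strings acting on an idempotent\<close>

lemma eventually_string_act_Nil: "eventually P (string_act [] U) \<longleftrightarrow> P 0"
  by (simp add: string_act_def eventually_principal)

lemma eventually_string_act_Cons:
  "eventually P (string_act (a # \<sigma>) U) \<longleftrightarrow>
     eventually (\<lambda>n. eventually (\<lambda>k. P (a * n + k)) (string_act \<sigma> U)) U"
  by (simp add: string_act_def eventually_uf_add eventually_filtermap)

lemma string_act_append:
  "string_act (\<sigma> @ \<tau>) U = uf_add (string_act \<sigma> U) (string_act \<tau> U)"
  by (induction \<sigma>) (simp_all add: string_act_def uf_add_zero_left uf_add_assoc)

lemma string_act_cong:
  assumes U: "idempotent_ultrafilter U" and "\<sigma> \<approx> \<tau>"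
  shows "string_act \<sigma> U = string_act \<tau> U"
  using assms(2)
proof induction
  case zero
  have "U \<noteq> bot"
    using U by (simp add: idempotent_ultrafilter_def ultrafilter_def)
  then show ?case
    by (simp add: filter_eq_iff eventually_string_act_Nil eventually_string_act_Cons)
next
  case (dup a)
  have "eventually P U \<longleftrightarrow> eventually (\<lambda>n. eventually (\<lambda>k. P (n + k)) U) U" for P
    using U by (metis eventually_uf_add idempotent_ultrafilter_def)
  from this[of "\<lambda>n. _ (a * n)"] show ?case
    by (simp add: filter_eq_iff eventually_string_act_Nil eventually_string_act_Cons algebra_simps)
qed (simp_all add: string_act_append)

text \<open>
  A statement that holds for almost all \<open>n\<^sub>1\<close>, for almost all \<open>n\<^sub>2\<close>, and so on, has a witness, and
  finitely many such statements with the same number of quantifiers have a common one, because \<open>U\<close> is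
  closed under finite intersections. This is where the strings of a solution must have equal length.
\<close>

lemma string_act_common_point:
  assumes "U \<noteq> bot" "finite J"
    and "\<And>j. j \<in> J \<Longrightarrow> length (s j) = L"
    and "\<And>j. j \<in> J \<Longrightarrow> eventually (P j) (string_act (s j) U)"
  obtains y where "\<And>j. j \<in> J \<Longrightarrow> P j (\<Sum>t<L. s j ! t * y t)"
proof -
  have "\<exists>y. \<forall>j\<in>J. P j (\<Sum>t<L. s j ! t * y t)"
    using assms(3,4)
  proof (induction L arbitrary: s P)
    case 0
    then show ?case
      by (auto simp: eventually_string_act_Nil)
  next
    case (Suc L)
    have s: "s j = hd (s j) # tl (s j)" if "j \<in> J" for j
      using Suc.prems(1)[OF that] by (cases "s j") auto
    have "eventually (\<lambda>n. eventually (\<lambda>k. P j (hd (s j) * n + k)) (string_act (tl (s j)) U)) U"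
      if "j \<in> J" for j
      using Suc.prems(2)[OF that] s[OF that] by (metis eventually_string_act_Cons)
    then have "eventually (\<lambda>n. \<forall>j\<in>J.
        eventually (\<lambda>k. P j (hd (s j) * n + k)) (string_act (tl (s j)) U)) U"
      using assms(2) by (simp add: eventually_ball_finite)
    then obtain n where n: "\<forall>j\<in>J. eventually (\<lambda>k. P j (hd (s j) * n + k)) (string_act (tl (s j)) U)"
      using assms(1) eventually_happens by blast
    obtain y where y: "\<forall>j\<in>J. P j (hd (s j) * n + (\<Sum>t<L. tl (s j) ! t * y t))"
      using Suc.IH[of "\<lambda>j. tl (s j)" "\<lambda>j k. P j (hd (s j) * n + k)"] Suc.prems(1) n by auto
    have "P j (\<Sum>t<Suc L. s j ! t * case_nat n y t)" if "j \<in> J" for j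
      unfolding sum.lessThan_Suc_shift using y that by (subst s[OF that], subst s[OF that]) simp
    then show ?case
      by blast
  qed
  then show ?thesis
    using that by blast
qed

lemma models_zero_of_solvable:
  assumes "solvable_in_class c \<sigma>" and U: "idempotent_ultrafilter U"
  shows "models_zero (string_act \<sigma> U) (length c) (lin_form c)"
  unfolding models_zero_def
proof (intro allI impI)
  fix A assume A: "eventually (\<lambda>n. n \<in> A) (string_act \<sigma> U)"
  obtain s L where s: "length s = length c" "set s \<subseteq> string_class \<sigma>" "\<forall>\<tau>\<in>set s. length \<tau> = L"
      "\<forall>t<L. (\<Sum>j<length c. c ! j * (s ! j) ! t) = 0"
    using assms(1) unfolding solvable_in_class_def by auto
  have mem: "s ! j \<in> set s" if "j < length c" for j
    using s(1) that by simp
  obtain y where y: "\<And>j. j \<in> {..<length c} \<Longrightarrow> (\<Sum>t<L. s ! j ! t * y t) \<in> A"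
  proof (rule string_act_common_point[of U "{..<length c}" "\<lambda>j. s ! j" L "\<lambda>_ n. n \<in> A"])
    show "U \<noteq> bot"
      using U by (simp add: idempotent_ultrafilter_def ultrafilter_def)
    fix j assume "j \<in> {..<length c}"
    then have "s ! j \<in> set s" by (simp add: mem)
    then show "length (s ! j) = L" "eventually (\<lambda>n. n \<in> A) (string_act (s ! j) U)"
      using s(2,3) string_act_cong[OF U] A by (auto simp: string_class_def)
  qed auto
  let ?b = "map (\<lambda>j. \<Sum>t<L. s ! j ! t * y t) [0..<length c]"
  have "lin_form c ?b = (\<Sum>j<length c. \<Sum>t<L. c ! j * s ! j ! t * y t)"
    by (simp add: lin_form_def sum_distrib_left mult.assoc)
  also have "\<dots> = (\<Sum>t<L. (\<Sum>j<length c. c ! j * s ! j ! t) * y t)"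
    by (subst sum.swap) (simp add: sum_distrib_right)
  also have "\<dots> = 0"
    using s(4) by simp
  finally show "\<exists>b. length b = length c \<and> set b \<subseteq> A \<and> lin_form c b = 0"
    using y by (intro exI[of _ ?b]) auto
qed

section \<open>Generic elements as strings over the sequence\<close>

lemma string_equiv_zeros: "set \<tau> \<subseteq> {0} \<Longrightarrow> \<tau> \<approx> []"
proof (induction \<tau>)
  case Nil
  show ?case by (rule string_equiv.refl)
next
  case (Cons a \<tau>)
  then have "[a] @ \<tau> \<approx> [] @ []"
    by (intro string_equiv.append) (auto intro: string_equiv.sym string_equiv.zero)
  then show ?case by simp
qed

lemma string_equiv_singleton:
  assumes "set \<tau> \<subseteq> {0, a}" "a \<in> set \<tau>"
  shows "\<tau> \<approx> [a]"
  using assms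
proof (induction \<tau>)
  case (Cons b \<tau>)
  show ?case
  proof (cases "a \<in> set \<tau>")
    case True
    then have \<tau>: "\<tau> \<approx> [a]"
      using Cons by auto
    have "[b] @ [a] \<approx> [a]"
    proof (cases "b = a")
      case True
      then show ?thesis
        by (auto intro: string_equiv.sym string_equiv.dup)
    next
      case False
      then have "[b] \<approx> []"
        using Cons.prems by (intro string_equiv_zeros) auto
      from string_equiv.append[OF this string_equiv.refl[of "[a]"]] show ?thesis
        by simp
    qed
    then show ?thesis
      using string_equiv.append[OF string_equiv.refl[of "[b]"] \<tau>] string_equiv.trans by fastforce
  next
    case False
    then have "b = a" "\<tau> \<approx> []"
      using Cons.prems by (auto intro!: string_equiv_zeros)
    then show ?thesis
      using string_equiv.append[OF string_equiv.refl[of "[a]"], of \<tau> "[]"] by simp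
  qed
qed simp

text \<open>
  A coefficient sequence supported on \<open>{k..<N}\<close> which, read there as a string, belongs to the class of
  \<open>\<sigma>\<close>. The endpoint \<open>N\<close> is a parameter so that the strings of a solution can be brought to a common
  length by appending zeros.
\<close>

definition spells :: "int list \<Rightarrow> nat \<Rightarrow> nat \<Rightarrow> (nat \<Rightarrow> int) \<Rightarrow> bool" where
  "spells \<sigma> k N d \<longleftrightarrow> k \<le> N \<and> (\<forall>t. t \<notin> {k..<N} \<longrightarrow> d t = 0) \<and>
     range d \<subseteq> insert 0 (set \<sigma>) \<and> map d [k..<N] \<approx> \<sigma>"

lemma spells_extend:
  assumes d: "spells \<sigma> k N d" and N: "N \<le> N'"
  shows "spells \<sigma> k N' d" and "(\<Sum>t\<in>{k..<N'}. d t * x t) = (\<Sum>t\<in>{k..<N}. d t * x t)"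
proof -
  have "map d [N..<N'] \<approx> []"
    using d unfolding spells_def by (intro string_equiv_zeros) auto
  then have "map d [k..<N] @ map d [N..<N'] \<approx> \<sigma> @ []"
    using d unfolding spells_def by (intro string_equiv.append) auto
  moreover have "[k..<N'] = [k..<N] @ [N..<N']"
    using d N unfolding spells_def by (metis le_Suc_ex upt_add_eq_append)
  ultimately show "spells \<sigma> k N' d"
    using d N unfolding spells_def by auto
  show "(\<Sum>t\<in>{k..<N'}. d t * x t) = (\<Sum>t\<in>{k..<N}. d t * x t)"
    using d N unfolding spells_def by (intro sum.mono_neutral_right) auto
qed

text \<open>
  Almost every element of \<open>(a \<sigma>) U\<close> is \<open>a n + m\<close> with \<open>n = \<Sum>\<^sub>t\<^sub>\<in>\<^sub>F x\<^sub>t\<close>, where \<open>m\<close> may be taken generic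
  for \<open>\<sigma> U\<close> after \<open>n\<close> is known, hence with all indices beyond \<open>F\<close>. The coefficients of \<open>a n\<close>
  form a string over \<open>0\<close> and \<open>a\<close> that contains \<open>a\<close>, which is equivalent to \<open>[a]\<close>.
\<close>

lemma eventually_spells:
  assumes FS: "\<And>k. k \<ge> k0 \<Longrightarrow> eventually (\<lambda>n. n \<in> FS x k) U"
  shows "k \<ge> k0 \<Longrightarrow> eventually (\<lambda>n. \<exists>d N. spells \<sigma> k N d \<and> n = (\<Sum>t\<in>{k..<N}. d t * x t))
           (string_act \<sigma> U)"
proof (induction \<sigma> arbitrary: k)
  case Nil
  have "spells [] k k (\<lambda>_. 0)"
    by (auto simp: spells_def string_equiv.refl)
  then show ?case
    unfolding eventually_string_act_Nil by force
next
  case (Cons a \<sigma>)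
  show ?case
    unfolding eventually_string_act_Cons
  proof (rule eventually_mono[OF FS[OF Cons.prems]])
    fix n assume "n \<in> FS x k"
    then obtain F where F: "finite F" "F \<noteq> {}" "F \<subseteq> {k..}" "n = (\<Sum>t\<in>F. x t)"
      unfolding FS_def by auto
    define l where "l = Suc (Max F)"
    have Fl: "F \<subseteq> {k..<l}"
      using F by (force simp: l_def less_Suc_eq_le)
    then have kl: "k \<le> l"
      using F(2) by fastforce
    define d where "d t = (if t \<in> F then a else 0)" for t
    have "map d [k..<l] \<approx> [a]"
      using Fl F(2) by (intro string_equiv_singleton) (force simp: d_def)+
    have an: "a * n = (\<Sum>t\<in>{k..<l}. d t * x t)"
    proof -
      have "(\<Sum>t\<in>{k..<l}. d t * x t) = (\<Sum>t\<in>F. d t * x t)"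
        using Fl by (intro sum.mono_neutral_right) (auto simp: d_def)
      then show ?thesis
        by (simp add: F(4) d_def sum_distrib_left)
    qed
    have "l \<ge> k0"
      using kl Cons.prems by simp
    from Cons.IH[OF this]
    show "eventually (\<lambda>m. \<exists>d N. spells (a # \<sigma>) k N d \<and> a * n + m = (\<Sum>t\<in>{k..<N}. d t * x t))
            (string_act \<sigma> U)"
    proof (rule eventually_mono, elim exE conjE)
      fix m d' N assume d': "spells \<sigma> l N d'" and m: "m = (\<Sum>t\<in>{l..<N}. d' t * x t)"
      define d'' where "d'' t = (if t < l then d t else d' t)" for t
      have lN: "l \<le> N"
        using d' by (simp add: spells_def)
      then have upt: "[k..<N] = [k..<l] @ [l..<N]"
        using kl by (metis le_Suc_ex upt_add_eq_append)
      have "map d'' [k..<N] = map d [k..<l] @ map d' [l..<N]"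
        by (simp add: upt d''_def)
      also have "\<dots> \<approx> [a] @ \<sigma>"
        using d' \<open>map d [k..<l] \<approx> [a]\<close> by (intro string_equiv.append) (auto simp: spells_def)
      finally have "spells (a # \<sigma>) k N d''"
        using d' kl lN Fl unfolding spells_def by (fastforce simp: d''_def d_def)
      moreover have "a * n + m = (\<Sum>t\<in>{k..<N}. d'' t * x t)"
      proof -
        have "(\<Sum>t\<in>{k..<N}. d'' t * x t) = (\<Sum>t\<in>{k..<l}. d'' t * x t) + (\<Sum>t\<in>{l..<N}. d'' t * x t)"
          using kl lN by (simp add: sum.atLeastLessThan_concat)
        then show ?thesis
          by (simp add: an m d''_def)
      qed
      ultimately show "\<exists>d N. spells (a # \<sigma>) k N d \<and> a * n + m = (\<Sum>t\<in>{k..<N}. d t * x t)"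
        by blast
    qed
  qed
qed

section \<open>Uniqueness of expansions over a fast growing sequence\<close>

lemma summation_by_parts:
  fixes x e :: "nat \<Rightarrow> int"
  defines "S \<equiv> \<lambda>k. \<Sum>i=1..k. x i"
  shows "k \<ge> 1 \<Longrightarrow> (\<Sum>t=1..k. e t * x t) = e k * S k + (\<Sum>t=1..<k. (e t - e (t + 1)) * S t)"
proof (induction k rule: dec_induct)
  case (step k)
  then show ?case
    by (simp add: S_def algebra_simps)
qed (simp add: S_def)

text \<open>
  The \<open>\<bar>S k\<bar>\<close> grow at least by the factor \<open>E\<close>, so \<open>E - 1\<close> times the sum of the earlier ones is at most
  \<open>\<bar>S k\<bar>\<close>. In the summation by parts these therefore contribute at most \<open>E / (E - 1) \<le> 2\<close> times
  \<open>\<bar>S k\<bar>\<close>, and the last term at most \<open>(E - 1) \<bar>S k\<bar>\<close>.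
\<close>

lemma expansion_bound:
  fixes x e :: "nat \<Rightarrow> int"
  defines "S \<equiv> \<lambda>k. \<Sum>i=1..k. x i"
  assumes E: "E \<ge> 2"
    and growth: "\<And>k. k \<ge> 1 \<Longrightarrow> \<bar>x (k + 1)\<bar> > (E + 1) * \<bar>S k\<bar>"
    and e: "\<And>t. \<bar>e t\<bar> \<le> E - 1" and e': "\<And>t. \<bar>e t - e (t + 1)\<bar> \<le> E"
    and k: "k \<ge> 1"
  shows "\<bar>\<Sum>t=1..k. e t * x t\<bar> \<le> (E + 1) * \<bar>S k\<bar>"
proof -
  let ?Q = "\<lambda>k. \<Sum>t=1..<k. \<bar>S t\<bar>"
  have grow_S: "\<bar>S (Suc k)\<bar> \<ge> E * \<bar>S k\<bar>" if "k \<ge> 1" for k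
    using growth[OF that] by (simp add: S_def algebra_simps)
  have "(E - 1) * ?Q k \<le> \<bar>S k\<bar>"
    using k
  proof (induction k rule: dec_induct)
    case (step k)
    then show ?case
      using grow_S[of k] by (simp add: algebra_simps)
  qed simp
  moreover have "E * ?Q k \<le> (2 * (E - 1)) * ?Q k"
    using E by (intro mult_right_mono sum_nonneg) auto
  ultimately have Q: "E * ?Q k \<le> 2 * \<bar>S k\<bar>"
    by (simp add: algebra_simps)
  have "\<bar>\<Sum>t=1..<k. (e t - e (t + 1)) * S t\<bar> \<le> (\<Sum>t=1..<k. E * \<bar>S t\<bar>)"
    using e' by (intro order_trans[OF sum_abs] sum_mono) (auto simp: abs_mult intro!: mult_right_mono)
  also have "\<dots> = E * ?Q k"
    by (simp add: sum_distrib_left)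
  finally have "\<bar>\<Sum>t=1..<k. (e t - e (t + 1)) * S t\<bar> \<le> 2 * \<bar>S k\<bar>"
    using Q by simp
  moreover have "\<bar>e k * S k\<bar> \<le> (E - 1) * \<bar>S k\<bar>"
    using e by (auto simp: abs_mult intro!: mult_right_mono)
  ultimately show ?thesis
    using summation_by_parts[OF k, where x = x and e = e] unfolding S_def
    by (simp only: left_diff_distrib distrib_right)
qed

text \<open>
  The growth condition says nothing about \<open>x 1\<close>, which may be \<open>0\<close>; hence the assumption on \<open>e 1\<close>.
\<close>

lemma expansion_unique:
  fixes x e :: "nat \<Rightarrow> int"
  assumes E: "E \<ge> 2"
    and growth: "\<And>k. k \<ge> 1 \<Longrightarrow> \<bar>x (k + 1)\<bar> > (E + 1) * \<bar>\<Sum>i=1..k. x i\<bar>"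
    and e: "\<And>t. \<bar>e t\<bar> \<le> E - 1" and e': "\<And>t. \<bar>e t - e (t + 1)\<bar> \<le> E"
    and "e 1 = 0"
    and "(\<Sum>t=1..k. e t * x t) = 0" and "t \<in> {1..k}"
  shows "e t = 0"
  using assms(6,7)
proof (induction k)
  case (Suc k)
  show ?case
  proof (cases "k = 0")
    case True
    then show ?thesis
      using Suc.prems \<open>e 1 = 0\<close> by simp
  next
    case False
    have "\<bar>e (Suc k)\<bar> * \<bar>x (Suc k)\<bar> = \<bar>\<Sum>t=1..k. e t * x t\<bar>"
      using Suc.prems(1) by (simp add: abs_mult[symmetric])
    also have "\<dots> \<le> (E + 1) * \<bar>\<Sum>i=1..k. x i\<bar>"
      using E growth e e' False by (intro expansion_bound) auto
    also have "\<dots> < \<bar>x (Suc k)\<bar>"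
      using growth[of k] False by simp
    finally have "e (Suc k) = 0"
      by (smt (verit) mult_le_cancel_right1)
    then show ?thesis
      using Suc by (cases "t = Suc k") auto
  qed
qed simp

section \<open>From an ultrafilter to a solution in the class\<close>

lemma abs_sum_coeffs_le:
  fixes c :: "int list" and B :: int
  assumes "\<And>j. j < length c \<Longrightarrow> \<bar>d j\<bar> \<le> B"
  shows "\<bar>\<Sum>j<length c. c ! j * d j\<bar> \<le> B * (\<Sum>b\<leftarrow>c. \<bar>b\<bar>)"
proof -
  have "\<bar>\<Sum>j<length c. c ! j * d j\<bar> \<le> (\<Sum>j<length c. B * \<bar>c ! j\<bar>)"
    using assms
    by (intro order_trans[OF sum_abs] sum_mono) (auto simp: abs_mult mult.commute intro!: mult_right_mono)
  then show ?thesis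
    by (simp add: sum_distrib_left sum_list_sum_nth atLeast0LessThan)
qed

lemma abs_le_sum_list_abs: "a \<in> set \<sigma> \<Longrightarrow> \<bar>a\<bar> \<le> (\<Sum>b\<leftarrow>\<sigma>. \<bar>b :: int\<bar>)"
  by (induction \<sigma>) (auto simp: sum_list_abs_nonneg intro: add_increasing)

text \<open>
  Either \<open>u = v\<close>, or the nonzero ones among \<open>u\<close> and \<open>v\<close> are entries of \<open>\<sigma>\<close> at distinct positions, so
  that both \<open>\<bar>u\<bar>\<close> and \<open>\<bar>v\<bar>\<close> occur in the sum.
\<close>

lemma abs_diff_le_sum_list_abs:
  "u \<in> insert 0 (set \<sigma>) \<Longrightarrow> v \<in> insert 0 (set \<sigma>) \<Longrightarrow> \<bar>u - v\<bar> \<le> (\<Sum>b\<leftarrow>\<sigma>. \<bar>b :: int\<bar>)"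
proof (induction \<sigma>)
  case (Cons a \<sigma>)
  have nn: "(\<Sum>b\<leftarrow>\<sigma>. \<bar>b\<bar>) \<ge> 0"
    by (rule sum_list_abs_nonneg)
  have le: "\<bar>w\<bar> \<le> (\<Sum>b\<leftarrow>\<sigma>. \<bar>b\<bar>)" if "w \<in> insert 0 (set \<sigma>)" for w
    using that abs_le_sum_list_abs nn by auto
  consider "u \<in> insert 0 (set \<sigma>)" "v \<in> insert 0 (set \<sigma>)" | "u = a" "v = a"
    | "u = a" "v \<in> insert 0 (set \<sigma>)" | "u \<in> insert 0 (set \<sigma>)" "v = a"
    using Cons.prems by auto
  then show ?case
  proof cases
    case 1
    then show ?thesis using Cons.IH by simp
  next
    case 2
    then show ?thesis using nn by simp
  next
    case 3
    then show ?thesis using le[of v] by simp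
  next
    case 4
    then show ?thesis using le[of u] by simp
  qed
qed simp

lemma sum_list_abs_ge_length:
  "\<forall>a\<in>set c. a \<noteq> (0::int) \<Longrightarrow> int (length c) \<le> (\<Sum>b\<leftarrow>c. \<bar>b\<bar>)"
  by (induction c) auto

lemma abs_le_sum_list_abs_minus_1:
  assumes "\<forall>a\<in>set \<sigma>. a \<noteq> (0::int)" "length \<sigma> \<ge> 2" "u \<in> insert 0 (set \<sigma>)"
  shows "\<bar>u\<bar> \<le> (\<Sum>b\<leftarrow>\<sigma>. \<bar>b\<bar>) - 1"
proof (cases "u = 0")
  case True
  then show ?thesis
    using sum_list_abs_ge_length[OF assms(1)] assms(2) by simp
next
  case False
  then have u: "u \<in> set \<sigma>" using assms by simp
  have "(\<Sum>b\<leftarrow>\<sigma>. \<bar>b\<bar>) = \<bar>u\<bar> + (\<Sum>b\<leftarrow>remove1 u \<sigma>. \<bar>b\<bar>)"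
    using u by (rule sum_list_map_remove1)
  moreover have "int (length (remove1 u \<sigma>)) \<le> (\<Sum>b\<leftarrow>remove1 u \<sigma>. \<bar>b\<bar>)"
    using assms(1) by (intro sum_list_abs_ge_length) (use set_remove1_subset[of u \<sigma>] in blast)
  ultimately show ?thesis
    using assms(2) u by (simp add: length_remove1)
qed

text \<open>
  A negative coefficient contributes at most \<open>0\<close> to a sum of selected coefficients, but at least \<open>1\<close> to
  the sum of the absolute values.
\<close>

lemma subset_sum_le:
  fixes c :: "int list"
  assumes "\<And>j. j < length c \<Longrightarrow> u j \<in> {0, 1}" and "i < length c" "c ! i < 0"
  shows "(\<Sum>j<length c. c ! j * u j) \<le> (\<Sum>b\<leftarrow>c. \<bar>b\<bar>) - 1"
proof -
  have "1 \<le> \<bar>c ! i\<bar> - c ! i * u i"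
    using assms(1)[OF assms(2)] assms(3) by auto
  also have "\<dots> \<le> (\<Sum>j<length c. \<bar>c ! j\<bar> - c ! j * u j)"
    using assms(1,2) by (intro member_le_sum) fastforce+
  finally show ?thesis
    by (simp add: sum_subtractf sum_list_sum_nth atLeast0LessThan)
qed

lemma abs_subset_sum_le:
  fixes c :: "int list"
  assumes u: "\<And>j. j < length c \<Longrightarrow> u j \<in> {0, 1}"
    and i: "i < length c" "c ! i < 0" and i': "i' < length c" "c ! i' > 0"
  shows "\<bar>\<Sum>j<length c. c ! j * u j\<bar> \<le> (\<Sum>b\<leftarrow>c. \<bar>b\<bar>) - 1"
proof -
  have "- (\<Sum>j<length c. c ! j * u j) = (\<Sum>j<length (map uminus c). map uminus c ! j * u j)"
    by (simp add: sum_negf)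
  also have "\<dots> \<le> (\<Sum>b\<leftarrow>map uminus c. \<bar>b\<bar>) - 1"
    using u i' by (intro subset_sum_le[of _ _ i']) auto
  finally have "- (\<Sum>j<length c. c ! j * u j) \<le> (\<Sum>b\<leftarrow>c. \<bar>b\<bar>) - 1"
    by (simp add: o_def)
  then show ?thesis
    using subset_sum_le[where u = u, OF u i] by simp
qed

text \<open>
  The product bound of \<open>abs_sum_coeffs_le\<close> is improved by one through either factor: if \<open>\<sigma>\<close> has at
  least two entries, no single entry exhausts \<open>\<Sum> \<bar>a\<bar>\<close>, and if \<open>\<sigma>\<close> is \<open>[a]\<close>, the combination is \<open>a\<close> times a subset sum of \<open>c\<close>,
  which cannot reach \<open>\<Sum> \<bar>b\<bar>\<close> when both signs occur in \<open>c\<close>.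
\<close>

lemma abs_combination_le:
  fixes \<sigma> c :: "int list"
  assumes \<sigma>: "\<sigma> \<noteq> []" "\<forall>a\<in>set \<sigma>. a \<noteq> 0" and c: "c \<noteq> []" "\<forall>b\<in>set c. b \<noteq> 0"
    and exc: "\<not> (length \<sigma> = 1 \<and> ((\<forall>b\<in>set c. b > 0) \<or> (\<forall>b\<in>set c. b < 0)))"
    and d: "\<And>j. j < length c \<Longrightarrow> d j \<in> insert 0 (set \<sigma>)"
  shows "\<bar>\<Sum>j<length c. c ! j * d j\<bar> \<le> (\<Sum>a\<leftarrow>\<sigma>. \<bar>a\<bar>) * (\<Sum>b\<leftarrow>c. \<bar>b\<bar>) - 1"
    and "(\<Sum>a\<leftarrow>\<sigma>. \<bar>a\<bar>) * (\<Sum>b\<leftarrow>c. \<bar>b\<bar>) \<ge> 2"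
proof -
  let ?A = "\<Sum>a\<leftarrow>\<sigma>. \<bar>a\<bar>" and ?C = "\<Sum>b\<leftarrow>c. \<bar>b\<bar>"
  have len: "int (length \<sigma>) \<le> ?A" "int (length c) \<le> ?C"
    using \<sigma> c by (auto intro: sum_list_abs_ge_length)
  have pos: "?A \<ge> 1" "?C \<ge> 1"
    using len \<sigma>(1) c(1) by (auto simp: neq_Nil_conv)
  have "\<bar>\<Sum>j<length c. c ! j * d j\<bar> \<le> ?A * ?C - 1 \<and> ?A * ?C \<ge> 2"
  proof (cases "length \<sigma> = 1")
    case False
    then have two: "length \<sigma> \<ge> 2"
      using \<sigma>(1) by (cases \<sigma>) (auto simp: Suc_le_eq)
    have "\<bar>\<Sum>j<length c. c ! j * d j\<bar> \<le> (?A - 1) * ?C"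
      using abs_le_sum_list_abs_minus_1[OF \<sigma>(2) two] d by (intro abs_sum_coeffs_le) auto
    moreover have "2 * 1 \<le> ?A * ?C"
      using len two pos by (intro mult_mono) auto
    ultimately show ?thesis
      using pos by (simp add: algebra_simps)
  next
    case True
    then obtain a where a: "\<sigma> = [a]"
      by (auto simp: length_Suc_conv)
    obtain i i' where i: "i < length c" "c ! i < 0" "i' < length c" "c ! i' > 0"
      using exc True c(2) by (metis in_set_conv_nth linorder_neqE_linordered_idom)
    define u where "u j = (if d j = 0 then 0 else 1 :: int)" for j
    have du: "d j = a * u j" if "j < length c" for j
      using d[OF that] a by (auto simp: u_def)
    have "(\<Sum>j<length c. c ! j * d j) = a * (\<Sum>j<length c. c ! j * u j)"
      by (simp add: du sum_distrib_left algebra_simps)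
    moreover have "\<bar>a\<bar> * \<bar>\<Sum>j<length c. c ! j * u j\<bar> \<le> \<bar>a\<bar> * (?C - 1)"
      using i by (intro mult_left_mono abs_subset_sum_le) (auto simp: u_def)
    moreover have "length c \<noteq> 1"
      using i by (auto simp: length_Suc_conv)
    then have "length c \<ge> 2"
      using i by (cases "length c") auto
    then have "1 * 2 \<le> ?A * ?C"
      using len pos by (intro mult_mono) auto
    ultimately show ?thesis
      using pos a by (simp add: abs_mult algebra_simps)
  qed
  then show "\<bar>\<Sum>j<length c. c ! j * d j\<bar> \<le> ?A * ?C - 1" "?A * ?C \<ge> 2"
    by auto
qed

lemma not_models_zero_same_sign:
  assumes U: "ultrafilter U" "eventually (\<lambda>n. n \<noteq> 0) U" and "a \<noteq> 0" and "c \<noteq> []"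
    and c: "(\<forall>b\<in>set c. b > 0) \<or> (\<forall>b\<in>set c. b < 0)"
  shows "\<not> models_zero (string_act [a] U) (length c) (lin_form c)"
proof
  assume mz: "models_zero (string_act [a] U) (length c) (lin_form c)"
  obtain s :: int where s: "s \<noteq> 0" "eventually (\<lambda>n. sgn (a * n) = s) U"
  proof (cases "eventually (\<lambda>n. a * n > 0) U")
    case True
    then show ?thesis
      by (intro that[of 1]) (auto elim: eventually_mono)
  next
    case False
    then have "eventually (\<lambda>n. \<not> a * n > 0) U"
      using ultrafilter_not_eventually[OF U(1)] by blast
    with U(2) have "eventually (\<lambda>n. sgn (a * n) = -1) U"
      by eventually_elim (use \<open>a \<noteq> 0\<close> in \<open>auto simp: sgn_if\<close>)
    then show ?thesis
      by (intro that[of "-1"]) auto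
  qed
  then have "eventually (\<lambda>n. n \<in> {n. sgn n = s}) (string_act [a] U)"
    by (simp add: eventually_string_act_Cons eventually_string_act_Nil)
  then obtain b where b: "length b = length c" "set b \<subseteq> {n. sgn n = s}" "lin_form c b = 0"
    using mz unfolding models_zero_def by blast
  obtain r :: int where r: "r \<noteq> 0" "\<And>j. j < length c \<Longrightarrow> sgn (c ! j) = r"
  proof (cases "\<forall>b\<in>set c. b > 0")
    case True
    then show ?thesis by (intro that[of 1]) auto
  next
    case False
    then show ?thesis using c by (intro that[of "-1"]) auto
  qed
  have bj: "sgn (b ! j) = s" if "j < length c" for j
    using b(1,2) that by (auto simp: subset_iff)
  have "c ! j * b ! j = r * s * \<bar>c ! j * b ! j\<bar>" if "j < length c" for j
    using r(2)[OF that] bj[OF that] by (metis sgn_mult mult_sgn_abs)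
  then have "lin_form c b = r * s * (\<Sum>j<length c. \<bar>c ! j * b ! j\<bar>)"
    by (simp add: lin_form_def sum_distrib_left)
  then have "(\<Sum>j<length c. \<bar>c ! j * b ! j\<bar>) = 0"
    using b(3) r(1) s(1) by simp
  then have "c ! 0 * b ! 0 = 0"
    using \<open>c \<noteq> []\<close> by (subst (asm) sum_nonneg_eq_0_iff) auto
  then show False
    using r(1) s(1) r(2)[of 0] bj[of 0] \<open>c \<noteq> []\<close> by auto
qed

text \<open>
  A finite sum is an expansion with coefficients \<open>0\<close> and \<open>1\<close>, which meet the bounds of
  \<open>expansion_unique\<close> once \<open>E \<ge> 2\<close>. For \<open>E = 1\<close> the terms
  \<open>x\<^sub>t = (-1)\<^sup>t (2 t - 1)\<close> satisfy the growth condition, and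
  \<open>0\<close> is one of their finite sums.
\<close>

lemma zero_notin_FS:
  assumes E: "E \<ge> 2"
    and growth: "\<And>k. k \<ge> 1 \<Longrightarrow> \<bar>x (k + 1)\<bar> > (E + 1) * \<bar>\<Sum>i=1..k. x i\<bar>"
  shows "0 \<notin> FS x 2"
proof
  assume "0 \<in> FS x 2"
  then obtain F where F: "finite F" "F \<noteq> {}" "F \<subseteq> {2..}" "(\<Sum>t\<in>F. x t) = 0"
    unfolding FS_def by auto
  define e :: "nat \<Rightarrow> int" where "e t = (if t \<in> F then 1 else 0)" for t
  have sub: "F \<subseteq> {1..Max F}"
    using F by force
  have "(\<Sum>t=1..Max F. e t * x t) = (\<Sum>t\<in>F. e t * x t)"
    using sub by (intro sum.mono_neutral_right) (auto simp: e_def)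
  also have "\<dots> = 0"
    using F(4) by (simp add: e_def)
  finally have sum0: "(\<Sum>t=1..Max F. e t * x t) = 0" .
  have "e (Max F) = 0"
  proof (rule expansion_unique[OF E growth _ _ _ sum0])
    show "Max F \<in> {1..Max F}"
      using F sub Max_in by blast
    show "e 1 = 0"
      using F(3) by (auto simp: e_def)
  qed (use E in \<open>auto simp: e_def\<close>)
  then show False
    using F Max_in by (simp add: e_def)
qed

lemma solvable_of_spelled_strings:
  assumes "\<And>j. j < length c \<Longrightarrow> spells \<sigma> k N (d j)"
    and "\<And>t. t \<in> {k..<N} \<Longrightarrow> (\<Sum>j<length c. c ! j * d j t) = 0"
  shows "solvable_in_class c \<sigma>"
  unfolding solvable_in_class_def
proof (intro exI conjI)
  let ?s = "map (\<lambda>j. map (d j) [k..<N]) [0..<length c]"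
  show "length ?s = length c" by simp
  show "set ?s \<subseteq> string_class \<sigma>"
    using assms(1) by (auto simp: string_class_def spells_def intro: string_equiv.sym)
  show "\<forall>\<tau>\<in>set ?s. length \<tau> = N - k" by auto
  show "\<forall>t<N - k. (\<Sum>j<length c. c ! j * ?s ! j ! t) = 0"
    using assms(2) by auto
qed

lemma solvable_of_sigma_P_ultrafilter:
  assumes \<sigma>: "\<forall>a\<in>set \<sigma>. a \<noteq> 0" and c: "c \<noteq> []" "\<forall>b\<in>set c. b \<noteq> 0"
    and U: "sigma_P_ultrafilter \<sigma> c U" "growth_const \<sigma> c = 2 \<longrightarrow> U \<noteq> principal {0}"
    and mz: "models_zero (string_act \<sigma> U) (length c) (lin_form c)"
  shows "solvable_in_class c \<sigma>"
proof (cases "\<sigma> = []")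
  case True
  then show ?thesis
    by (intro solvable_of_spelled_strings[of c \<sigma> 0 0 "\<lambda>_ _. 0"])
      (auto simp: spells_def string_equiv.refl)
next
  case False
  define E where "E = (\<Sum>a\<leftarrow>\<sigma>. \<bar>a\<bar>) * (\<Sum>b\<leftarrow>c. \<bar>b\<bar>)"
  have gc: "growth_const \<sigma> c = E + 1"
    by (simp add: growth_const_eq E_def)
  have uf: "ultrafilter U"
    using U(1) by (simp add: sigma_P_ultrafilter_def idempotent_ultrafilter_def)
  obtain x where FS: "\<And>k. k \<ge> 1 \<Longrightarrow> eventually (\<lambda>n. n \<in> FS x k) U"
    and growth: "\<And>k. k \<ge> 1 \<Longrightarrow> \<bar>x (k + 1)\<bar> > (E + 1) * \<bar>\<Sum>i=1..k. x i\<bar>"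
    using U(1) unfolding sigma_P_ultrafilter_def gc by blast
  have notexc: "\<not> (length \<sigma> = 1 \<and> ((\<forall>b\<in>set c. b > 0) \<or> (\<forall>b\<in>set c. b < 0)))"
  proof
    assume exc: "length \<sigma> = 1 \<and> ((\<forall>b\<in>set c. b > 0) \<or> (\<forall>b\<in>set c. b < 0))"
    then obtain a where a: "\<sigma> = [a]" "a \<noteq> 0"
      using \<sigma> by (auto simp: length_Suc_conv)
    \<comment> \<open>The growth of \<open>x\<close> excludes the principal ultrafilter at \<open>0\<close> for \<open>E \<ge> 2\<close>; for \<open>E = 1\<close> it is excluded by assumption.\<close>
    have "eventually (\<lambda>n. n \<noteq> 0) U"
    proof (cases "E \<ge> 2")
      case True
      then have "0 \<notin> FS x 2"
        using growth by (rule zero_notin_FS)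
      with FS[of 2] show ?thesis
        by (auto elim: eventually_mono)
    next
      case False
      have "int (length c) \<le> (\<Sum>b\<leftarrow>c. \<bar>b\<bar>)"
        using c(2) by (rule sum_list_abs_ge_length)
      then have "(\<Sum>b\<leftarrow>c. \<bar>b\<bar>) > 0"
        using c(1) by (cases c) auto
      with a(2) have "\<bar>a\<bar> * (\<Sum>b\<leftarrow>c. \<bar>b\<bar>) > 0"
        by (intro mult_pos_pos) auto
      then have "E = 1"
        using False by (simp add: E_def a(1))
      then have "U \<noteq> principal {0}"
        using U(2) gc by simp
      moreover have "U = principal {0}" if "eventually (\<lambda>n. n = 0) U"
        using that uf
        by (intro ultrafilter_eqI)
          (auto simp: le_principal ultrafilter_def eventually_principal principal_eq_bot_iff)
      ultimately show ?thesis
        using ultrafilter_not_eventually[OF uf] by blast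
    qed
    then show False
      using not_models_zero_same_sign[OF uf _ a(2) c(1)] exc mz a(1) by blast
  qed
  \<comment> \<open>The supports start at \<open>2\<close> because \<open>x 1\<close> may vanish.\<close>
  let ?G = "{n. \<exists>d N. spells \<sigma> 2 N d \<and> n = (\<Sum>t\<in>{2..<N}. d t * x t)}"
  have "eventually (\<lambda>n. n \<in> ?G) (string_act \<sigma> U)"
    using eventually_spells[of 1 x U 2 \<sigma>] FS by simp
  then obtain b where b: "length b = length c" "set b \<subseteq> ?G" "lin_form c b = 0"
    using mz unfolding models_zero_def by blast
  have "\<forall>j\<in>{..<length c}. \<exists>d N. spells \<sigma> 2 N d \<and> b ! j = (\<Sum>t\<in>{2..<N}. d t * x t)"
    using b(1,2) by (auto simp: subset_iff)
  then obtain d N where d: "\<And>j. j < length c \<Longrightarrow> spells \<sigma> 2 (N j) (d j)"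
      "\<And>j. j < length c \<Longrightarrow> b ! j = (\<Sum>t\<in>{2..<N j}. d j t * x t)"
    by (metis lessThan_iff)
  define K where "K = Suc (\<Sum>j<length c. N j)"
  have K: "N j \<le> K" if "j < length c" for j
    using member_le_sum[of j "{..<length c}" N] that by (simp add: K_def)
  have dK: "spells \<sigma> 2 K (d j)" "b ! j = (\<Sum>t\<in>{2..<K}. d j t * x t)" if "j < length c" for j
    using spells_extend[OF d(1)[OF that] K[OF that]] d(2)[OF that] by auto
  define e where "e t = (\<Sum>j<length c. c ! j * d j t)" for t
  have dset: "d j t \<in> insert 0 (set \<sigma>)" if "j < length c" for j t
    using dK(1)[OF that] unfolding spells_def by blast
  have "e 1 = 0" 
    using dK(1) by (simp add: e_def spells_def)
  have E: "E \<ge> 2"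
    unfolding E_def using abs_combination_le(2)[OF False \<sigma> c notexc] by fastforce
  have "(\<Sum>t\<in>{2..<K}. e t * x t) = (\<Sum>j<length c. c ! j * (\<Sum>t\<in>{2..<K}. d j t * x t))"
    unfolding e_def sum_distrib_left sum_distrib_right by (subst sum.swap) (simp add: mult.assoc)
  also have "\<dots> = lin_form c b"
    by (simp add: lin_form_def dK(2))
  finally have sum0: "(\<Sum>t\<in>{2..<K}. e t * x t) = 0"
    using b(3) by simp
  have "(\<Sum>t=1..K - 1. e t * x t) = (\<Sum>t\<in>{2..<K}. e t * x t)"
  proof (rule sum.mono_neutral_right)
    show "\<forall>t\<in>{1..K - 1} - {2..<K}. e t * x t = 0"
    proof
      fix t assume "t \<in> {1..K - 1} - {2..<K}"
      then have "t = 1" by auto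
      then show "e t * x t = 0" using \<open>e 1 = 0\<close> by simp
    qed
  qed auto
  with sum0 have sum0: "(\<Sum>t=1..K - 1. e t * x t) = 0"
    by simp
  have "e t = 0" if "t \<in> {2..<K}" for t
  proof (rule expansion_unique[OF E growth _ _ \<open>e 1 = 0\<close> sum0])
    show "\<bar>e t\<bar> \<le> E - 1" for t
      unfolding e_def E_def using dset by (intro abs_combination_le(1)[OF False \<sigma> c notexc]) auto
    show "\<bar>e t - e (t + 1)\<bar> \<le> E" for t
    proof -
      have "e t - e (t + 1) = (\<Sum>j<length c. c ! j * (d j t - d j (t + 1)))"
        by (simp add: e_def sum_subtractf algebra_simps)
      also have "\<bar>\<dots>\<bar> \<le> E"
        unfolding E_def using dset by (intro abs_sum_coeffs_le abs_diff_le_sum_list_abs) auto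
      finally show ?thesis .
    qed
    show "t \<in> {1..K - 1}"
      using that by auto
  qed auto
  then show ?thesis
    using dK(1) by (intro solvable_of_spelled_strings[of c \<sigma> 2 K d]) (auto simp: e_def)
qed

section \<open>Equivalence of the three conditions\<close>

theorem theorem5p3:
  fixes \<sigma> c :: "int list"
  assumes "reduced \<sigma>"
    and "length c \<ge> 1"
    and "\<forall>j<length c. c ! j \<noteq> 0"
  shows "((\<forall>U. idempotent_ultrafilter U \<longrightarrow>
             models_zero (string_act \<sigma> U) (length c) (lin_form c))
          \<longleftrightarrow>
          (\<exists>U. sigma_P_ultrafilter \<sigma> c U \<and>
             (growth_const \<sigma> c = 2 \<longrightarrow> U \<noteq> principal {0}) \<and>
             models_zero (string_act \<sigma> U) (length c) (lin_form c)))
         \<and>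
         ((\<exists>U. sigma_P_ultrafilter \<sigma> c U \<and>
             (growth_const \<sigma> c = 2 \<longrightarrow> U \<noteq> principal {0}) \<and>
             models_zero (string_act \<sigma> U) (length c) (lin_form c))
          \<longleftrightarrow>
          solvable_in_class c \<sigma>)"
proof -
  let ?all = "\<forall>U. idempotent_ultrafilter U \<longrightarrow>
    models_zero (string_act \<sigma> U) (length c) (lin_form c)"
  let ?some = "\<exists>U. sigma_P_ultrafilter \<sigma> c U \<and> (growth_const \<sigma> c = 2 \<longrightarrow> U \<noteq> principal {0}) \<and>
    models_zero (string_act \<sigma> U) (length c) (lin_form c)"
  have "?all \<Longrightarrow> ?some"
  proof -
    assume ?all
    obtain U where "sigma_P_ultrafilter \<sigma> c U" "U \<noteq> principal {0}"
      by (rule sigma_P_ultrafilter_exists)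
    then show ?thesis
      using \<open>?all\<close> by (auto simp: sigma_P_ultrafilter_def)
  qed
  moreover have "?some \<Longrightarrow> solvable_in_class c \<sigma>"
  proof -
    assume ?some
    have "\<forall>a\<in>set \<sigma>. a \<noteq> 0" "c \<noteq> []" "\<forall>b\<in>set c. b \<noteq> 0"
      using assms by (auto simp: reduced_def in_set_conv_nth)
    with \<open>?some\<close> show ?thesis
      using solvable_of_sigma_P_ultrafilter by blast
  qed
  moreover have "solvable_in_class c \<sigma> \<Longrightarrow> ?all"
    using models_zero_of_solvable by blast
  ultimately show ?thesis
    by blast
qed

end
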